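(* Let $L$ be the operator generated by a kernel $k$ (symmetric, integrable, non-trivial, nonnegative, $k(0)=0$), let $S=\mathrm{supp}(k)$, and suppose that $$\sum_{j\in S}k(j)\log\Big(2+\frac1{k(j)}\Big)<\infty .$$ Let $G:[0,\infty)\to[0,\infty)$, $G(a)=\int_0^a\rho^{-1}(s)\,\mathrm{d}s$, where $\rho^{-1}$ is the inverse of the strictly increasing bijection $\rho:[0,\infty)\to[0,\infty)$ defined by $\rho(0)=0$ and $\rho(\lambda)=\sum_{j\in S}k(j)\,(H')^{-1}\big(\tfrac{\lambda}{k(j)}\big)$ for $\lambda>0$, with $H(x)=\frac12e^{-x}\Upsilon(2x)$. Then $G$ is a strictly convex $CD$-function, $L$ satisfies $CD_\Upsilon(0,G)$, and $$G(a)\sim \frac{|k|_1}{2}\,\exp\Big(\frac{a-M(k)}{|k|_1}\Big)\quad\text{as } a\to\infty,\qquad\text{where } M(k)=\sum_{j\in S}k(j)\log\Big(\frac1{k(j)}\Big).$$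
   Context: Kernel and operator: $k:\mathbb{Z}\to[0,\infty)$ is not identically zero, $k(0)=0$, $k(j)=k(-j)$ for all $j$, and $|k|_1:=\sum_{j\in\mathbb{Z}}k(j)<\infty$. The operator generated by $k$ is $Lu(x)=\sum_{j\in\mathbb{Z}}k(j)\big(u(x+j)-u(x)\big)$, $x\in\mathbb{Z}$. $\mathrm{supp}(k)=\{j\in\mathbb{Z}:k(j)\neq 0\}$. $\ell^\infty(\mathbb{Z})$ denotes the bounded functions $\mathbb{Z}\to\mathbb{R}$. $f\sim g$ as $x\to x_0$ means $f(x)/g(x)\to1$ as $x\to x_0$. Let $\Upsilon(r)=e^r-1-r$, $r\in\mathbb{R}$. The function $H(x)=\frac12e^{-x}\Upsilon(2x)$ has derivative $H'(x)=\frac12(e^x-e^{-x}+2xe^{-x})$, which is a strictly increasing bijection of $\mathbb{R}$ with $H'(0)=0$; $(H')^{-1}$ is its inverse. For $u,v\in\ell^\infty(\mathbb{Z})$ put $\Psi_\Upsilon(u)(x)=\sum_{y\in\mathbb{Z}}k(x-y)\Upsilon(u(y)-u(x))$, $B_{\Upsilon'}(u,v)(x)=\sum_{y\in\mathbb{Z}}k(x-y)\Upsilon'(u(y)-u(x))(v(y)-v(x))$ and $\Psi_{2,\Upsilon}(u)(x)=\frac12\big(L\Psi_\Upsilon(u)(x)-B_{\Upsilon'}(u,Lu)(x)\big)$. A $CD$-function is a continuous $F:[0,\infty)\to[0,\infty)$ with $F(0)=0$, $r\mapsto F(r)/r$ strictly increasing on $(0,\infty)$, and $1/F$ integrable at $\infty$.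 $L$ satisfies $CD_\Upsilon(0,F)$ if for every $u\in\ell^\infty(\mathbb{Z})$ and every $x\in\mathbb{Z}$: $\Psi_{2,\Upsilon}(u)(x)\ge F(-Lu(x))$ whenever $-Lu(x)\ge 0$ (and $\Psi_{2,\Upsilon}(u)(x)\ge 0$ otherwise). *)

theory Defs
  imports "HOL-Analysis.Analysis" "HOL-Library.Landau_Symbols"
begin

definition Upsilon :: "real \<Rightarrow> real" where
  "Upsilon r = exp r - 1 - r"

definition H :: "real \<Rightarrow> real" where
  "H x = exp (- x) * Upsilon (2 * x) / 2"

lemma deriv_Upsilon: "deriv Upsilon r = exp r - 1"
  unfolding Upsilon_def by (rule DERIV_imp_deriv) (auto intro!: derivative_eq_intros)

lemma deriv_H: "deriv H x = (exp x - exp (- x) + 2 * x * exp (- x)) / 2"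
proof -
  have "exp (- x) * exp (2 * x) = exp x"
    by (simp flip: exp_add)
  moreover have "(H has_real_derivative
      (exp (- x) * (2 * exp (2 * x) - 2) - exp (- x) * (exp (2 * x) - 1 - 2 * x)) / 2) (at x)"
    unfolding H_def Upsilon_def by (auto intro!: derivative_eq_intros)
  ultimately show ?thesis
    by (intro DERIV_imp_deriv) (simp add: algebra_simps)
qed

definition supp :: "(int \<Rightarrow> real) \<Rightarrow> int set" where
  "supp k = {j. k j \<noteq> 0}"

(* For a summable nonnegative kernel k and bounded u, v, all the series in the next four
   definitions converge absolutely, so the value 0 that infsum takes on divergent families
   never occurs. *)

definition L :: "(int \<Rightarrow> real) \<Rightarrow> (int \<Rightarrow> real) \<Rightarrow> int \<Rightarrow> real" where
  "L k u x = (\<Sum>\<^sub>\<infinity>j\<in>UNIV. k j * (u (x + j) - u x))"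

definition Psi_Upsilon :: "(int \<Rightarrow> real) \<Rightarrow> (int \<Rightarrow> real) \<Rightarrow> int \<Rightarrow> real" where
  "Psi_Upsilon k u x = (\<Sum>\<^sub>\<infinity>y\<in>UNIV. k (x - y) * Upsilon (u y - u x))"

definition B_Upsilon' :: "(int \<Rightarrow> real) \<Rightarrow> (int \<Rightarrow> real) \<Rightarrow> (int \<Rightarrow> real) \<Rightarrow> int \<Rightarrow> real" where
  "B_Upsilon' k u v x = (\<Sum>\<^sub>\<infinity>y\<in>UNIV. k (x - y) * deriv Upsilon (u y - u x) * (v y - v x))"

definition Psi2_Upsilon :: "(int \<Rightarrow> real) \<Rightarrow> (int \<Rightarrow> real) \<Rightarrow> int \<Rightarrow> real" where
  "Psi2_Upsilon k u x = (L k (Psi_Upsilon k u) x - B_Upsilon' k u (L k u) x) / 2"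

(* Functions on [0,\<infinity>) are total functions on the reals of which only the values on {0..} matter. *)

definition CD_function :: "(real \<Rightarrow> real) \<Rightarrow> bool" where
  "CD_function F \<longleftrightarrow>
     continuous_on {0..} F \<and> (\<forall>r\<ge>0. F r \<ge> 0) \<and> F 0 = 0 \<and>
     strict_mono_on {0<..} (\<lambda>r. F r / r) \<and>
     (\<exists>R>0. set_integrable lborel {R..} (\<lambda>r. 1 / F r))"

definition satisfies_CD_Upsilon_0 :: "(int \<Rightarrow> real) \<Rightarrow> (real \<Rightarrow> real) \<Rightarrow> bool" where
  "satisfies_CD_Upsilon_0 k F \<longleftrightarrow>
     (\<forall>u. bounded (range u) \<longrightarrow>
        (\<forall>x. Psi2_Upsilon k u x \<ge> (if - L k u x \<ge> 0 then F (- L k u x) else 0)))"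

definition strictly_convex_on :: "real set \<Rightarrow> (real \<Rightarrow> real) \<Rightarrow> bool" where
  "strictly_convex_on A f \<longleftrightarrow> convex A \<and>
     (\<forall>x\<in>A. \<forall>y\<in>A. \<forall>t. x \<noteq> y \<and> 0 < t \<and> t < 1 \<longrightarrow>
        f ((1 - t) * x + t * y) < (1 - t) * f x + t * f y)"

(* deriv H is a bijection of the whole real line, so inv (deriv H) is its genuine inverse. *)

definition rho :: "(int \<Rightarrow> real) \<Rightarrow> real \<Rightarrow> real" where
  "rho k l = (if l > 0 then \<Sum>\<^sub>\<infinity>j\<in>supp k. k j * inv (deriv H) (l / k j) else 0)"

definition rho_inv :: "(int \<Rightarrow> real) \<Rightarrow> real \<Rightarrow> real" where
  "rho_inv k = the_inv_into {0..} (rho k)"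

definition G :: "(int \<Rightarrow> real) \<Rightarrow> real \<Rightarrow> real" where
  "G k a = integral {0..a} (rho_inv k)"

definition norm1 :: "(int \<Rightarrow> real) \<Rightarrow> real" where
  "norm1 k = (\<Sum>\<^sub>\<infinity>j\<in>UNIV. k j)"

definition M :: "(int \<Rightarrow> real) \<Rightarrow> real" where
  "M k = (\<Sum>\<^sub>\<infinity>j\<in>supp k. k j * ln (1 / k j))"

end

theory Submission
  imports Defs "HOL-Real_Asymp.Real_Asymp"
begin

text \<open>
  Write \<open>a j = u (x + j) - u x\<close> and \<open>d i j = u (x + i + j) - u (x + i) - u (x + j) + u x\<close>. Expanding
  the definition and exchanging the two summation indices gives
  \<open>4 * \<Psi>\<^sub>2 (u) (x) = \<Sum>i j. k i * k j * (exp (a i) + exp (a j)) * \<Upsilon> (d i j)\<close>,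
  and every term is nonnegative. Keeping only the terms with \<open>i = - j\<close>, for which
  \<open>d i j = - (a j + a (- j))\<close>, and applying the arithmetic-geometric mean inequality to the
  exponentials yields
  \<open>\<Psi>\<^sub>2 (u) (x) \<ge> \<Sum>j. (k j)\<^sup>2 * H (s j)\<close> with \<open>s j = - (a j + a (- j)) / 2\<close>
  (lemma \<open>Psi2_Upsilon_ge\<close>), where \<open>\<Sum>j. k j * s j = - L u x\<close> by the symmetry of \<open>k\<close>
  (lemma \<open>symmetrized_increment\<close>).

  The curvature inequality is thereby reduced to minimizing \<open>\<Sum>j. (k j)\<^sup>2 * H (s j)\<close> under the
  constraint \<open>\<Sum>j. k j * s j = a\<close>. The Lagrange condition reads \<open>H' (s j) = \<lambda> / k j\<close>, and the
  constraint becomes \<open>\<rho> (\<lambda>) = a\<close>; this is where \<open>\<rho>\<close> comes from. Convexity of \<open>H\<close>, used through its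
  tangents, shows that the critical point is the minimum and that the multiplier \<open>\<rho>\<^sup>-\<^sup>1 a\<close> is a
  subgradient at \<open>a\<close> of the minimal value (lemma \<open>min_energy_le\<close>). As \<open>\<rho>\<^sup>-\<^sup>1\<close> is continuous, the
  minimal value has derivative \<open>\<rho>\<^sup>-\<^sup>1\<close>, so it is \<open>G\<close> (lemma \<open>G_eq_min_energy\<close>). The same
  subgradients increase strictly, hence \<open>G\<close> is strictly convex, and with \<open>G 0 = 0\<close> its quotient
  \<open>G r / r\<close> increases strictly.

  For the growth, \<open>(H')\<^sup>-\<^sup>1 s = ln (2 * s) + o(1)\<close>. Since \<open>k\<close> is bounded, the error is uniform over the
  terms of \<open>\<rho>\<close>, and \<open>\<rho> \<lambda> = |k|\<^sub>1 * ln (2 * \<lambda>) + M(k) + o(1)\<close> (lemma \<open>rho_asymp\<close>). Inverting and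
  integrating gives the asymptotics of \<open>G\<close>, and the exponential growth makes \<open>1 / G\<close> integrable at
  infinity.
\<close>

section \<open>The function \<open>H\<close> and the inverse of its derivative\<close>

lemma Upsilon_nonneg: "Upsilon r \<ge> 0"
  unfolding Upsilon_def using exp_ge_add_one_self[of r] by linarith

lemma H_nonneg: "H x \<ge> 0"
  unfolding H_def using Upsilon_nonneg by simp

lemma H_eq: "H x = (exp x - exp (- x) - 2 * x * exp (- x)) / 2"
proof -
  have "exp (- x) * exp (2 * x) = exp x"
    by (simp flip: exp_add)
  then show ?thesis
    unfolding H_def Upsilon_def by (simp add: algebra_simps)
qed

text \<open>The gap \<open>H' - H\<close> equals \<open>2 x exp (- x)\<close>. At a point where \<open>H'\<close> takes the value
  \<open>\<lambda> / k j\<close>, this caps the energy \<open>(k j)\<^sup>2 H\<close> by the summable quantity \<open>\<lambda> k j\<close>.\<close>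

lemma H_le_deriv_H:
  assumes "x \<ge> 0"
  shows "H x \<le> deriv H x"
  using assms by (simp add: H_eq deriv_H)

lemma H_has_deriv: "(H has_real_derivative deriv H x) (at x)"
  unfolding deriv_H unfolding H_eq[abs_def]
  by (auto intro!: derivative_eq_intros simp: field_simps)

lemma deriv_H_has_deriv:
  "(deriv H has_real_derivative (exp x + exp (- x) * (3 - 2 * x)) / 2) (at x)"
  unfolding deriv_H[abs_def]
  by (auto intro!: derivative_eq_intros simp: field_simps)

text \<open>The fraction is \<open>H''\<close>. After factoring out \<open>exp (- x)\<close>, positivity reduces to
  \<open>exp (2 * x) \<ge> 1 + 2 * x\<close>.\<close>

lemma second_deriv_H_pos: "(exp x + exp (- x) * (3 - 2 * x)) / 2 > (0::real)"
proof -
  have "exp x = exp (- x) * exp (2 * x)"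
    by (simp flip: exp_add)
  then have "exp x + exp (- x) * (3 - 2 * x) = exp (- x) * (exp (2 * x) + 3 - 2 * x)"
    by (simp add: algebra_simps)
  moreover have "exp (2 * x) + 3 - 2 * x > 0"
    using exp_ge_add_one_self[of "2 * x"] by linarith
  ultimately show ?thesis
    by simp
qed

lemma deriv_H_strict_mono: "strict_mono (deriv H)"
  using DERIV_pos_imp_increasing deriv_H_has_deriv second_deriv_H_pos
  by (intro strict_monoI) blast

lemma H_above_tangent: "H s \<ge> H y + deriv H y * (s - y)"
proof -
  have "convex_on UNIV H"
    by (rule f''_ge0_imp_convex[OF _ H_has_deriv deriv_H_has_deriv])
       (use second_deriv_H_pos less_imp_le in auto)
  then have "H s - H y \<ge> deriv H y * (s - y)"
    by (rule convex_on_imp_above_tangent) (use H_has_deriv in auto)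
  then show ?thesis by simp
qed

lemma continuous_on_deriv_H: "continuous_on A (deriv H)"
  by (meson DERIV_isCont continuous_at_imp_continuous_on deriv_H_has_deriv)

lemma surj_deriv_H: "surj (deriv H)"
proof -
  have top: "filterlim (deriv H) at_top at_top"
    unfolding deriv_H[abs_def] by real_asymp
  have bot: "filterlim (deriv H) at_bot at_bot"
    unfolding deriv_H[abs_def] by real_asymp
  have "\<exists>x. deriv H x = y" for y
  proof -
    obtain b where b: "deriv H b \<ge> y"
      using eventually_happens[OF filterlim_at_top[THEN iffD1, rule_format, OF top, of y]] by auto
    obtain a where a: "deriv H a \<le> y"
      using eventually_happens[OF filterlim_at_bot[THEN iffD1, rule_format, OF bot, of y]] by auto
    have "a \<le> b"
      using a b strict_mono_less_eq[OF deriv_H_strict_mono, of a b] by simp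
    then show ?thesis
      using IVT'[of "deriv H" a y b] a b continuous_on_deriv_H by blast
  qed
  then show ?thesis unfolding surj_def by (simp add: eq_commute)
qed

abbreviation H'_inv :: "real \<Rightarrow> real" where
  "H'_inv \<equiv> inv (deriv H)"

lemma deriv_H_H'_inv [simp]: "deriv H (H'_inv s) = s"
  by (simp add: surj_deriv_H surj_f_inv_f)

lemma H'_inv_deriv_H [simp]: "H'_inv (deriv H x) = x"
  using deriv_H_strict_mono by (simp add: strict_mono_imp_inj_on)

lemma H'_inv_strict_mono: "strict_mono H'_inv"
proof (rule strict_monoI)
  fix s t :: real
  assume "s < t"
  then have "deriv H (H'_inv s) < deriv H (H'_inv t)"
    by simp
  then show "H'_inv s < H'_inv t"
    by (simp only: strict_mono_less[OF deriv_H_strict_mono])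
qed

lemma H'_inv_0 [simp]: "H'_inv 0 = 0"
  using H'_inv_deriv_H[of 0] by (simp add: deriv_H)

lemma H'_inv_nonneg: "s \<ge> 0 \<Longrightarrow> H'_inv s \<ge> 0"
  using strict_mono_less_eq[OF H'_inv_strict_mono, of 0 s] by simp

lemma isCont_H'_inv: "isCont H'_inv s"
proof -
  have "isCont H'_inv (deriv H (H'_inv s))"
    by (rule isCont_inverse_function[where d = 1])
       (use continuous_on_deriv_H[of UNIV] in \<open>auto simp: continuous_on_eq_continuous_at\<close>)
  then show ?thesis by simp
qed

lemma filterlim_H'_inv: "filterlim H'_inv at_top at_top"
  unfolding filterlim_at_top
proof
  fix Z
  show "\<forall>\<^sub>F s in at_top. Z \<le> H'_inv s"
    using eventually_ge_at_top[of "deriv H Z"]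
  proof eventually_elim
    case (elim s)
    then show ?case
      using strict_mono_less_eq[OF H'_inv_strict_mono, of "deriv H Z" s] by simp
  qed
qed

text \<open>For \<open>y \<ge> 0\<close> one has \<open>H' y \<ge> (exp y - 1) / 2\<close>. The resulting logarithmic growth of the inverse is
  what makes the logarithmic moment condition on the kernel sufficient for the convergence of
  \<open>\<rho>\<close>.\<close>

lemma H'_inv_le_ln:
  assumes "s \<ge> 0"
  shows "H'_inv s \<le> ln (1 + 2 * s)"
proof -
  define y where "y = H'_inv s"
  have y: "y \<ge> 0" "deriv H y = s"
    using H'_inv_nonneg[OF assms] by (auto simp: y_def)
  have s: "2 * s = exp y - exp (- y) + 2 * y * exp (- y)"
    using y(2) by (simp add: deriv_H)
  have "exp (- y) \<le> 1" "2 * y * exp (- y) \<ge> 0"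
    using y by auto
  then have "exp y \<le> 1 + 2 * s"
    using s by linarith
  then show ?thesis
    unfolding y_def[symmetric] using assms by (subst ln_ge_iff) auto
qed

text \<open>Substituting \<open>s = H' y\<close> turns the difference into
  \<open>- ln (1 + exp (- 2 * y) * (2 * y - 1))\<close>.\<close>

lemma H'_inv_asymp: "((\<lambda>s. H'_inv s - ln (2 * s)) \<longlongrightarrow> 0) at_top"
proof -
  have "((\<lambda>y::real. y - ln (2 * ((exp y - exp (- y) + 2 * y * exp (- y)) / 2))) \<longlongrightarrow> 0) at_top"
    by real_asymp
  from filterlim_compose[OF this[folded deriv_H] filterlim_H'_inv] show ?thesis
    unfolding deriv_H_H'_inv .
qed

section \<open>Infinite sums\<close>

lemma infsum_strict_mono:
  fixes f g :: "'a \<Rightarrow> real"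
  assumes "f summable_on A" "g summable_on A" "\<And>x. x \<in> A \<Longrightarrow> f x \<le> g x" "z \<in> A" "f z < g z"
  shows "infsum f A < infsum g A"
  using assms by (intro has_sum_strict_mono[where x = z, OF has_sum_infsum has_sum_infsum])

lemma has_sum_diff:
  fixes f g :: "'a \<Rightarrow> real"
  assumes "(f has_sum a) A" "(g has_sum b) A"
  shows "((\<lambda>x. f x - g x) has_sum (a - b)) A"
  using has_sum_add[OF assms(1) has_sum_uminusI[OF assms(2)]] by simp

lemma infsum_antidiagonal_le:
  fixes f :: "int \<times> int \<Rightarrow> real"
  assumes "f summable_on UNIV" and "\<And>p. f p \<ge> 0"
  shows "(\<lambda>j. f (j, - j)) summable_on UNIV" "(\<Sum>\<^sub>\<infinity>j. f (j, - j)) \<le> infsum f UNIV"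
proof -
  have bij: "bij_betw (\<lambda>j. (j, - j)) UNIV (range (\<lambda>j::int. (j, - j)))"
    by (auto simp: bij_betw_def inj_on_def)
  have sub: "f summable_on range (\<lambda>j. (j, - j))"
    using assms(1) summable_on_subset_banach by blast
  then show "(\<lambda>j. f (j, - j)) summable_on UNIV"
    unfolding summable_on_reindex_bij_betw[OF bij] .
  show "(\<Sum>\<^sub>\<infinity>j. f (j, - j)) \<le> infsum f UNIV"
    unfolding infsum_reindex_bij_betw[OF bij]
    using sub assms by (intro infsum_mono_neutral) auto
qed

section \<open>A lower bound for the second iterated operator\<close>

text \<open>The logarithmic moment condition is left to an extension of this locale, because it concerns the
  convergence of \<open>\<rho>\<close> and not the operators.\<close>

locale jump_kernel =
  fixes k :: "int \<Rightarrow> real"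
  assumes nonneg: "k j \<ge> 0"
    and symmetric: "k (- j) = k j"
    and summable: "k summable_on UNIV"
begin

lemma summable_mult_bounded:
  assumes "\<And>j. \<bar>f j\<bar> \<le> C"
  shows "(\<lambda>j. k j * f j) summable_on A"
proof -
  have "(\<lambda>j. k j * C) summable_on A"
    using summable summable_on_subset_banach by (intro summable_on_cmult_left) blast
  then have "(\<lambda>j. norm (k j * f j)) summable_on A"
    by (rule Infinite_Sum.abs_summable_on_comparison_test')
       (simp add: abs_mult nonneg assms mult_left_mono)
  then show ?thesis
    by (rule abs_summable_summable)
qed

lemma abs_infsum_mult_bounded:
  assumes "\<And>j. \<bar>f j\<bar> \<le> C"
  shows "\<bar>\<Sum>\<^sub>\<infinity>j. k j * f j\<bar> \<le> norm1 k * C"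
proof -
  have 1: "((\<lambda>j. k j * f j) has_sum (\<Sum>\<^sub>\<infinity>j. k j * f j)) UNIV"
    using assms by (intro has_sum_infsum summable_mult_bounded)
  have 2: "((\<lambda>j. k j * C) has_sum (norm1 k * C)) UNIV"
    unfolding norm1_def by (intro has_sum_cmult_left has_sum_infsum summable)
  show ?thesis
    using norm_infsum_le[OF 1 2] by (simp add: abs_mult nonneg assms mult_left_mono)
qed

lemma Psi_Upsilon_eq: "Psi_Upsilon k u x = (\<Sum>\<^sub>\<infinity>j. k j * Upsilon (u (x + j) - u x))"
proof -
  have "bij_betw ((+) x) UNIV UNIV"
    by (rule bij_plus)
  from infsum_reindex_bij_betw[OF this, of "\<lambda>y. k (x - y) * Upsilon (u y - u x)"]
  show ?thesis
    unfolding Psi_Upsilon_def by (simp add: symmetric)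
qed

lemma B_Upsilon'_eq:
  "B_Upsilon' k u v x = (\<Sum>\<^sub>\<infinity>j. k j * deriv Upsilon (u (x + j) - u x) * (v (x + j) - v x))"
proof -
  have "bij_betw ((+) x) UNIV UNIV"
    by (rule bij_plus)
  from infsum_reindex_bij_betw[OF this,
      of "\<lambda>y. k (x - y) * deriv Upsilon (u y - u x) * (v y - v x)"]
  show ?thesis
    unfolding B_Upsilon'_def by (simp add: symmetric)
qed

context
  fixes u :: "int \<Rightarrow> real" and x :: int
  assumes bounded: "bounded (range u)"
begin

definition increment :: "int \<Rightarrow> real" where
  "increment i = u (x + i) - u x"

definition mixed_difference :: "int \<Rightarrow> int \<Rightarrow> real" where
  "mixed_difference i j = u (x + i + j) - u (x + i) - u (x + j) + u x"

text \<open>With \<open>a\<close> the increments and \<open>d\<close> the mixed difference, this is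
  \<open>\<Upsilon> (a i + d) - \<Upsilon> (a i) - \<Upsilon>' (a j) * d\<close>, the quantity that \<open>2 * \<Psi>\<^sub>2\<close> averages against
  \<open>k i * k j\<close>. It is written without \<open>\<Upsilon>\<close> because the term \<open>- d\<close> coming from \<open>\<Upsilon>\<close> cancels the one from \<open>\<Upsilon>'\<close>.\<close>

definition Psi2_summand :: "int \<Rightarrow> int \<Rightarrow> real" where
  "Psi2_summand i j =
     exp (increment i) * (exp (mixed_difference i j) - 1)
     - exp (increment j) * mixed_difference i j"

lemma increment_bounded: "\<exists>C. \<forall>y z. \<bar>u y - u z\<bar> \<le> C"
proof -
  obtain C where C: "\<And>y. \<bar>u y\<bar> \<le> C"
    using bounded by (auto simp: bounded_iff)
  have "\<bar>u y - u z\<bar> \<le> 2 * C" for y z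
    using C[of y] C[of z] by linarith
  then show ?thesis by blast
qed

lemma Psi2_summand_bounded: "\<exists>C. \<forall>i j. \<bar>Psi2_summand i j\<bar> \<le> C"
proof -
  obtain C where C: "\<And>y z. \<bar>u y - u z\<bar> \<le> C"
    using increment_bounded by blast
  have C0: "C \<ge> 0" using C[of 0 0] by simp
  have "\<bar>Psi2_summand i j\<bar> \<le> exp C * (exp (2 * C) + 1) + exp C * (2 * C)" for i j
  proof -
    have d: "\<bar>mixed_difference i j\<bar> \<le> 2 * C"
      using C[of "x + i + j" "x + i"] C[of x "x + j"]
      unfolding mixed_difference_def by linarith
    have a: "exp (increment i) \<le> exp C" for i
      using C[of "x + i" x] unfolding increment_def by simp
    have e: "\<bar>exp (mixed_difference i j) - 1\<bar> \<le> exp (2 * C) + 1"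
      using d exp_gt_zero[of "mixed_difference i j"]
        exp_le_cancel_iff[of "mixed_difference i j" "2 * C"] by linarith
    show ?thesis
      unfolding Psi2_summand_def
      by (rule order_trans[OF abs_triangle_ineq4])
         (auto simp: abs_mult intro!: add_mono mult_mono a d e C0)
  qed
  then show ?thesis by blast
qed

lemma summable_product_bounded:
  assumes "\<And>i j. \<bar>f i j\<bar> \<le> C"
  shows "(\<lambda>(j, i). k j * (k i * f i j)) summable_on UNIV"
proof -
  have "(\<lambda>p. norm (case p of (j, i) \<Rightarrow> k j * (k i * f i j))) summable_on (UNIV \<times> UNIV)"
    unfolding Infinite_Sum.abs_summable_on_Sigma_iff
  proof (intro conjI ballI)
    fix j
    show "(\<lambda>i. norm (case (j, i) of (j, i) \<Rightarrow> k j * (k i * f i j))) summable_on UNIV"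
      using summable_mult_bounded[of "\<lambda>i. \<bar>f i j\<bar>" C UNIV] assms
      by (auto simp: abs_mult nonneg intro!: summable_on_cmult_right)
  next
    have "(\<lambda>j. k j * (\<Sum>\<^sub>\<infinity>i. k i * \<bar>f i j\<bar>)) summable_on UNIV"
      by (rule summable_mult_bounded[where C = "norm1 k * C"], rule abs_infsum_mult_bounded)
         (use assms in auto)
    moreover have "norm (\<Sum>\<^sub>\<infinity>i. norm (k j * (k i * f i j))) = k j * (\<Sum>\<^sub>\<infinity>i. k i * \<bar>f i j\<bar>)" for j
      by (simp add: abs_mult nonneg infsum_cmult_right' infsum_nonneg)
    ultimately show "(\<lambda>j. norm (\<Sum>\<^sub>\<infinity>i. norm (case (j, i) of (j, i) \<Rightarrow> k j * (k i * f i j)))) summable_on UNIV"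
      by simp
  qed
  then show ?thesis
    using abs_summable_summable by fastforce
qed

text \<open>Boundedness of \<open>u\<close> makes all series absolutely convergent, so \<open>L\<close> and \<open>B\<close> may be combined
  under one outer sum over \<open>j\<close>, and the differences of \<open>\<Psi>\<close> and of \<open>L u\<close> at \<open>x + j\<close> and \<open>x\<close> under one
  inner sum over \<open>i\<close>.\<close>

lemma L_Psi_minus_B_eq:
  "L k (Psi_Upsilon k u) x - B_Upsilon' k u (L k u) x
     = (\<Sum>\<^sub>\<infinity>j. k j * (\<Sum>\<^sub>\<infinity>i. k i * Psi2_summand i j))"
proof -
  obtain C where C: "\<And>y z. \<bar>u y - u z\<bar> \<le> C"
    using increment_bounded by blast
  define D where "D = exp C + 1 + C"
  have D: "\<bar>Upsilon (u y - u z)\<bar> \<le> D" for y z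
    using C[of y z] exp_le_cancel_iff[of "u y - u z" C] exp_gt_zero[of "u y - u z"]
    unfolding Upsilon_def D_def by linarith
  have D': "\<bar>deriv Upsilon (u y - u z)\<bar> \<le> D" for y z
    using C[of y z] exp_le_cancel_iff[of "u y - u z" C] exp_gt_zero[of "u y - u z"]
    unfolding deriv_Upsilon D_def by linarith
  have Psi: "((\<lambda>i. k i * Upsilon (u (y + i) - u y)) has_sum Psi_Upsilon k u y) UNIV" for y
    unfolding Psi_Upsilon_eq by (rule has_sum_infsum, rule summable_mult_bounded, rule D)
  have Lu: "((\<lambda>i. k i * (u (y + i) - u y)) has_sum L k u y) UNIV" for y
    unfolding L_def by (rule has_sum_infsum, rule summable_mult_bounded, rule C)
  have Psi_bound: "\<bar>Psi_Upsilon k u y\<bar> \<le> norm1 k * D" for y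
    unfolding Psi_Upsilon_eq by (rule abs_infsum_mult_bounded, rule D)
  have Lu_bound: "\<bar>L k u y\<bar> \<le> norm1 k * C" for y
    unfolding L_def by (rule abs_infsum_mult_bounded, rule C)
  define p where "p j = Psi_Upsilon k u (x + j) - Psi_Upsilon k u x" for j
  define q where "q j = deriv Upsilon (u (x + j) - u x) * (L k u (x + j) - L k u x)" for j
  have p_bound: "\<bar>p j\<bar> \<le> 2 * (norm1 k * D)" for j
    using Psi_bound[of "x + j"] Psi_bound[of x] unfolding p_def by linarith
  have "\<bar>L k u (x + j) - L k u x\<bar> \<le> 2 * (norm1 k * C)" for j
    using Lu_bound[of "x + j"] Lu_bound[of x] by linarith
  then have q_bound: "\<bar>q j\<bar> \<le> D * (2 * (norm1 k * C))" for j
    unfolding q_def abs_mult using D'[of "x + j" x] by (intro mult_mono) auto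
  have inner: "(\<Sum>\<^sub>\<infinity>i. k i * Psi2_summand i j) = p j - q j" for j
  proof (rule infsumI)
    have "((\<lambda>i. k i * Upsilon (u (x + j + i) - u (x + j)) - k i * Upsilon (u (x + i) - u x)
            - deriv Upsilon (u (x + j) - u x)
                * (k i * (u (x + j + i) - u (x + j)) - k i * (u (x + i) - u x)))
          has_sum (p j - q j)) UNIV"
      unfolding p_def q_def by (intro has_sum_diff has_sum_cmult_right Psi Lu)
    moreover have "k i * Upsilon (u (x + j + i) - u (x + j)) - k i * Upsilon (u (x + i) - u x)
            - deriv Upsilon (u (x + j) - u x)
                * (k i * (u (x + j + i) - u (x + j)) - k i * (u (x + i) - u x))
          = k i * Psi2_summand i j" for i
    proof -
      have "exp (u (x + j + i) - u (x + j)) = exp (increment i) * exp (mixed_difference i j)"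
        unfolding increment_def mixed_difference_def
        by (simp add: algebra_simps flip: exp_add)
      then show ?thesis
        unfolding Psi2_summand_def Upsilon_def deriv_Upsilon
        by (simp add: increment_def mixed_difference_def algebra_simps)
    qed
    ultimately show "((\<lambda>i. k i * Psi2_summand i j) has_sum (p j - q j)) UNIV"
      by simp
  qed
  have "L k (Psi_Upsilon k u) x - B_Upsilon' k u (L k u) x
      = (\<Sum>\<^sub>\<infinity>j. k j * p j) - (\<Sum>\<^sub>\<infinity>j. k j * q j)"
    unfolding B_Upsilon'_eq unfolding L_def[of k "Psi_Upsilon k u"] p_def q_def
    by (simp add: mult.assoc)
  also have "\<dots> = (\<Sum>\<^sub>\<infinity>j. k j * p j - k j * q j)"
    by (rule infsumI[symmetric], intro has_sum_diff has_sum_infsum)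
       (rule summable_mult_bounded, rule p_bound, rule summable_mult_bounded, rule q_bound)
  also have "\<dots> = (\<Sum>\<^sub>\<infinity>j. k j * (\<Sum>\<^sub>\<infinity>i. k i * Psi2_summand i j))"
    by (simp add: inner right_diff_distrib)
  finally show ?thesis .
qed

lemma mixed_difference_commute: "mixed_difference i j = mixed_difference j i"
  by (simp add: mixed_difference_def algebra_simps)

text \<open>The mixed difference is symmetric in its two shifts. Exchanging the shifts therefore pairs the
  exponential part of one summand with the linear part of the other, and the sum has a sign
  although the single summand has none.\<close>

lemma Psi2_summand_symmetrized:
  "Psi2_summand i j + Psi2_summand j i
     = (exp (increment i) + exp (increment j)) * Upsilon (mixed_difference i j)"
  by (simp add: Psi2_summand_def Upsilon_def mixed_difference_commute[of j i] algebra_simps)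

text \<open>On the antidiagonal the walk returns to its starting point, so the mixed difference is
  \<open>- (a + b)\<close> with \<open>a\<close> and \<open>b\<close> the increments at \<open>j\<close> and \<open>- j\<close>. The arithmetic-geometric mean
  inequality for \<open>exp a\<close> and \<open>exp b\<close> then leaves a function of \<open>a + b\<close> alone, and that function is
  \<open>H\<close>.\<close>

lemma Psi2_summand_antidiagonal:
  "Psi2_summand j (- j) + Psi2_summand (- j) j \<ge> 4 * H (- (increment j + increment (- j)) / 2)"
proof -
  define a b where "a = increment j" and "b = increment (- j)"
  have d: "mixed_difference j (- j) = - (a + b)"
    by (simp add: a_def b_def increment_def mixed_difference_def)
  have "(exp (a / 2) - exp (b / 2))\<^sup>2 = exp a + exp b - 2 * exp ((a + b) / 2)"
    by (simp add: power2_eq_square algebra_simps add_divide_distrib flip: exp_add)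
  then have "2 * exp ((a + b) / 2) \<le> exp a + exp b"
    using zero_le_power2[of "exp (a / 2) - exp (b / 2)"] by linarith
  then have "2 * exp ((a + b) / 2) * Upsilon (- (a + b)) \<le> (exp a + exp b) * Upsilon (- (a + b))"
    using Upsilon_nonneg by (rule mult_right_mono)
  moreover have "4 * H (- (a + b) / 2) = 2 * exp ((a + b) / 2) * Upsilon (- (a + b))"
  proof -
    define c where "c = (a + b) / 2"
    have c: "a + b = 2 * c"
      by (simp add: c_def)
    show ?thesis
      unfolding c H_def by simp
  qed
  ultimately have "4 * H (- (a + b) / 2) \<le> (exp a + exp b) * Upsilon (- (a + b))"
    by linarith
  then show ?thesis
    unfolding Psi2_summand_symmetrized d unfolding a_def b_def .
qed

text \<open>After symmetrization every term of the double sum is nonnegative; all of them are dropped except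
  those on the antidiagonal.\<close>

lemma Psi2_Upsilon_ge:
  defines "s \<equiv> \<lambda>j. - (increment j + increment (- j)) / 2"
  shows "(\<lambda>j. (k j)\<^sup>2 * H (s j)) summable_on UNIV"
    and "Psi2_Upsilon k u x \<ge> (\<Sum>\<^sub>\<infinity>j. (k j)\<^sup>2 * H (s j))"
proof -
  obtain C where C: "\<And>i j. \<bar>Psi2_summand i j\<bar> \<le> C"
    using Psi2_summand_bounded by blast
  define f where "f = (\<lambda>(j, i). k j * (k i * Psi2_summand i j))"
  \<comment> \<open>Exchanging the indices preserves the sum, so \<open>g\<close> has twice the sum of \<open>f\<close>.\<close>
  define g where "g p = f p + f (prod.swap p)" for p
  have f: "f summable_on UNIV"
    unfolding f_def using C by (rule summable_product_bounded)
  have bij: "bij_betw prod.swap UNIV (UNIV :: (int \<times> int) set)"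
    by (simp add: bij_swap)
  have f': "(\<lambda>p. f (prod.swap p)) summable_on UNIV"
    using f summable_on_reindex_bij_betw[OF bij] by blast
  have g: "g summable_on UNIV"
    unfolding g_def using f f' by (rule summable_on_add)
  have g_eq: "g (j, i) = k j * k i * (Psi2_summand i j + Psi2_summand j i)" for i j
    by (simp add: g_def f_def algebra_simps)
  have g_nonneg: "g p \<ge> 0" for p
    by (cases p) (simp add: g_eq Psi2_summand_symmetrized nonneg Upsilon_nonneg)
  have "2 * Psi2_Upsilon k u x = infsum f UNIV"
  proof -
    have "infsum f UNIV = (\<Sum>\<^sub>\<infinity>j. \<Sum>\<^sub>\<infinity>i. f (j, i))"
      using infsum_Sigma_banach[of f UNIV "\<lambda>_. UNIV"] f by simp
    then show ?thesis
      by (simp add: Psi2_Upsilon_def L_Psi_minus_B_eq f_def infsum_cmult_right')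
  qed
  moreover have "infsum g UNIV = 2 * infsum f UNIV"
    unfolding g_def using infsum_add[OF f f'] infsum_reindex_bij_betw[OF bij, of f] by simp
  ultimately have Psi2: "4 * Psi2_Upsilon k u x = infsum g UNIV"
    by simp
  have le: "4 * ((k j)\<^sup>2 * H (s j)) \<le> g (j, - j)" for j
    using mult_left_mono[OF Psi2_summand_antidiagonal[of j], of "(k j)\<^sup>2"]
    by (simp add: g_eq s_def symmetric power2_eq_square algebra_simps)
  have sum4: "(\<lambda>j. 4 * ((k j)\<^sup>2 * H (s j))) summable_on UNIV"
    by (rule summable_on_comparison_test[OF infsum_antidiagonal_le(1)[OF g g_nonneg] le])
       (simp add: H_nonneg)
  then show "(\<lambda>j. (k j)\<^sup>2 * H (s j)) summable_on UNIV"
    using summable_on_cmult_right[OF sum4, of "1 / 4"] by simp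
  have "4 * (\<Sum>\<^sub>\<infinity>j. (k j)\<^sup>2 * H (s j)) = (\<Sum>\<^sub>\<infinity>j. 4 * ((k j)\<^sup>2 * H (s j)))"
    by (simp add: infsum_cmult_right')
  also have "\<dots> \<le> (\<Sum>\<^sub>\<infinity>j. g (j, - j))"
    using sum4 infsum_antidiagonal_le(1)[OF g g_nonneg] le by (rule infsum_mono)
  also have "\<dots> \<le> 4 * Psi2_Upsilon k u x"
    unfolding Psi2 by (rule infsum_antidiagonal_le(2)[OF g g_nonneg])
  finally show "Psi2_Upsilon k u x \<ge> (\<Sum>\<^sub>\<infinity>j. (k j)\<^sup>2 * H (s j))"
    by simp
qed

text \<open>Averaging the increments over \<open>j\<close> and \<open>- j\<close> does not change their \<open>k\<close>-weighted sum, so the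
  energy bound and the value of \<open>- L u\<close> involve the same family \<open>s\<close>.\<close>

lemma symmetrized_increment:
  defines "s \<equiv> \<lambda>j. - (increment j + increment (- j)) / 2"
  shows "((\<lambda>j. k j * s j) has_sum (- L k u x)) UNIV"
proof -
  obtain C where C: "\<And>y z. \<bar>u y - u z\<bar> \<le> C"
    using increment_bounded by blast
  have 1: "((\<lambda>j. k j * increment j) has_sum L k u x) UNIV"
    unfolding L_def increment_def by (rule has_sum_infsum, rule summable_mult_bounded, rule C)
  have "bij_betw uminus UNIV (UNIV :: int set)"
    by (rule bij_uminus)
  from has_sum_reindex_bij_betw[OF this, of "\<lambda>j. k j * increment j"] 1
  have 2: "((\<lambda>j. k j * increment (- j)) has_sum L k u x) UNIV"
    by (simp add: symmetric)
  have "((\<lambda>j. (- 1 / 2) * (k j * increment j + k j * increment (- j))) has_sum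
      ((- 1 / 2) * (L k u x + L k u x))) UNIV"
    by (intro has_sum_cmult_right has_sum_add 1 2)
  moreover have "(- 1 / 2) * (k j * increment j + k j * increment (- j)) = k j * s j" for j
    by (simp add: s_def algebra_simps)
  ultimately show ?thesis by simp
qed

end

end

section \<open>Functions with a monotone family of subgradients\<close>

text \<open>The subgradient inequalities at the two endpoints trap each difference quotient between \<open>p x\<close> and
  \<open>p y\<close>, so a continuous choice of subgradients is a derivative.\<close>

lemma has_real_derivative_subgradient:
  fixes g p :: "real \<Rightarrow> real"
  assumes sub: "\<And>x y. x \<in> S \<Longrightarrow> y \<in> S \<Longrightarrow> g x + p x * (y - x) \<le> g y"
    and cont: "continuous_on S p" and x: "x \<in> S"
  shows "(g has_real_derivative p x) (at x within S)"
  unfolding has_field_derivative_iff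
proof -
  have "(p \<longlongrightarrow> p x) (at x within S)"
    using cont x by (auto simp: continuous_on_def)
  then have lim: "((\<lambda>y. \<bar>p y - p x\<bar>) \<longlongrightarrow> 0) (at x within S)"
    by (intro tendsto_rabs_zero iffD1[OF Lim_null])
  have "\<bar>(g y - g x) / (y - x) - p x\<bar> \<le> \<bar>p y - p x\<bar>" if y: "y \<in> S" "y \<noteq> x" for y
  proof -
    define q where "q = (g y - g x) / (y - x)"
    have q: "g y - g x = q * (y - x)"
      using y by (simp add: q_def)
    have 1: "(q - p x) * (y - x) \<ge> 0" "(p y - q) * (y - x) \<ge> 0"
      using sub[OF x y(1)] sub[OF y(1) x] q by (auto simp: algebra_simps)
    show ?thesis
    proof (cases "y > x")
      case True
      then show ?thesis
        using 1 unfolding q_def[symmetric] by (simp add: zero_le_mult_iff)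
    next
      case False
      then show ?thesis
        using 1 y unfolding q_def[symmetric] by (simp add: zero_le_mult_iff)
    qed
  qed
  then have "\<forall>\<^sub>F y in at x within S. norm ((g y - g x) / (y - x) - p x) \<le> \<bar>p y - p x\<bar>"
    by (auto simp: eventually_at_filter)
  then have "((\<lambda>y. (g y - g x) / (y - x) - p x) \<longlongrightarrow> 0) (at x within S)"
    using lim by (rule Lim_null_comparison)
  then show "((\<lambda>y. (g y - g x) / (y - x)) \<longlongrightarrow> p x) (at x within S)"
    by (rule iffD2[OF Lim_null])
qed

text \<open>Passing through the midpoint \<open>m\<close> uses the subgradient at \<open>x\<close> on the first half and the strictly
  better one at \<open>m\<close> on the second half.\<close>

lemma strict_subgradient:
  fixes g p :: "real \<Rightarrow> real"
  assumes S: "convex S"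
    and sub: "\<And>x y. x \<in> S \<Longrightarrow> y \<in> S \<Longrightarrow> g x + p x * (y - x) \<le> g y"
    and mono: "strict_mono_on S p"
    and xy: "x \<in> S" "y \<in> S" "x \<noteq> y"
  shows "g x + p x * (y - x) < g y"
proof -
  define m where "m = (1 / 2) * x + (1 / 2) * y"
  have m: "m \<in> S"
    using convexD[OF S xy(1,2), of "1 / 2" "1 / 2"] by (simp add: m_def)
  have ym: "y - m = (y - x) / 2"
    by (simp add: m_def field_simps)
  have "(p m - p x) * (y - x) > 0"
  proof (cases "x < y")
    case True
    then have "p x < p m"
      using strict_mono_onD[OF mono xy(1) m] by (simp add: m_def)
    then show ?thesis using True by simp
  next
    case False
    then have "p m < p x"
      using strict_mono_onD[OF mono m xy(1)] xy(3) by (simp add: m_def)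
    then show ?thesis using False xy(3) by (simp add: zero_less_mult_iff)
  qed
  then have "p x * (y - x) < p m * (y - x)"
    by (simp add: left_diff_distrib)
  then have "p x * (y - m) < p m * (y - m)"
    unfolding ym by simp
  moreover have "p x * (y - x) = p x * (m - x) + p x * (y - m)"
    by (simp add: algebra_simps)
  ultimately show ?thesis
    using sub[OF xy(1) m] sub[OF m xy(2)] by linarith
qed

text \<open>The affine minorant at the intermediate point \<open>z\<close> lies strictly below \<open>g\<close> at both endpoints, and
  its convex combination there is \<open>g z\<close>.\<close>

lemma strictly_convex_on_subgradient:
  fixes g p :: "real \<Rightarrow> real"
  assumes S: "convex S"
    and sub: "\<And>x y. x \<in> S \<Longrightarrow> y \<in> S \<Longrightarrow> g x + p x * (y - x) \<le> g y"
    and mono: "strict_mono_on S p"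
  shows "strictly_convex_on S g"
  unfolding strictly_convex_on_def
proof (intro conjI S ballI allI impI)
  fix x y t :: real
  assume x: "x \<in> S" and y: "y \<in> S" and t: "x \<noteq> y \<and> 0 < t \<and> t < 1"
  define z where "z = (1 - t) * x + t * y"
  have z: "z \<in> S"
    using convexD[OF S x y, of "1 - t" t] t by (simp add: z_def)
  have zx: "x - z = t * (x - y)" and zy: "y - z = (1 - t) * (y - x)"
    by (simp_all add: z_def algebra_simps)
  have "(1 - t) * (g z + p z * (x - z)) + t * (g z + p z * (y - z))
      < (1 - t) * g x + t * g y"
  proof (rule add_strict_mono)
    have "z \<noteq> x" "z \<noteq> y"
      using zx zy t by auto
    then show "(1 - t) * (g z + p z * (x - z)) < (1 - t) * g x"
      "t * (g z + p z * (y - z)) < t * g y"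
      using strict_subgradient[OF S sub mono z] x y t by (auto intro!: mult_strict_left_mono)
  qed
  moreover have "(1 - t) * (g z + p z * (x - z)) + t * (g z + p z * (y - z)) = g z"
    unfolding zx zy by (simp add: algebra_simps)
  ultimately show "g ((1 - t) * x + t * y) < (1 - t) * g x + t * g y"
    by (simp add: z_def)
qed

lemma strictly_convex_on_quotient_strict_mono:
  assumes "strictly_convex_on {0..} g" "g 0 = 0"
  shows "strict_mono_on {0<..} (\<lambda>r. g r / r)"
proof (rule strict_mono_onI)
  fix r s :: real
  assume "r \<in> {0<..}" "s \<in> {0<..}" and rs: "r < s"
  then have pos: "r > 0" "s > 0" by auto
  have "g ((1 - r / s) * 0 + r / s * s) < (1 - r / s) * g 0 + r / s * g s"
    using assms(1) pos rs unfolding strictly_convex_on_def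
    by (elim conjE ballE[of _ _ 0] ballE[of _ _ s] allE[of _ "r / s"]) auto
  then show "g r / r < g s / s"
    using pos assms(2) by (simp add: field_simps)
qed

lemma continuous_on_atLeast:
  fixes f :: "real \<Rightarrow> 'a :: topological_space"
  assumes "\<And>b. continuous_on {a..b} f"
  shows "continuous_on {a..} f"
  unfolding continuous_on_def
proof
  fix x assume x: "x \<in> {a..}"
  have "(f \<longlongrightarrow> f x) (at x within {a..x + 1})"
    using assms[of "x + 1"] x by (auto simp: continuous_on_def)
  moreover have "at x within {a..} = at x within {a..x + 1}"
    by (rule at_within_nhd[of x "{x - 1<..<x + 1}"]) auto
  ultimately show "(f \<longlongrightarrow> f x) (at x within {a..})"
    by simp
qed

lemma set_integrable_exp_decay:
  fixes c :: real
  assumes "c > 0"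
  shows "set_integrable lborel {R..} (\<lambda>x. exp (- c * x))"
proof -
  have "set_integrable lebesgue {R..} (\<lambda>x. exp (- c * x))"
    using integrable_on_exp_minus_to_infinity[OF assms]
    by (intro nonnegative_absolutely_integrable_1) auto
  moreover have "(\<lambda>x. indicator {R..} x *\<^sub>R exp (- c * x)) \<in> borel_measurable lborel"
    by measurable
  ultimately show ?thesis
    unfolding set_integrable_def by (simp add: integrable_completion)
qed

section \<open>The function \<open>\<rho>\<close> and its inverse\<close>

locale log_kernel = jump_kernel +
  assumes nontrivial: "\<exists>j. k j \<noteq> 0"
    and log_summable: "(\<lambda>j. k j * ln (2 + 1 / k j)) summable_on supp k"
begin

lemma supp_pos: "j \<in> supp k \<Longrightarrow> k j > 0"
  using nonneg[of j] by (simp add: supp_def)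

lemma has_sum_supp_iff:
  assumes "\<And>j. k j = 0 \<Longrightarrow> f j = 0"
  shows "(f has_sum s) (supp k) \<longleftrightarrow> (f has_sum s) UNIV"
  using assms by (intro has_sum_cong_neutral) (auto simp: supp_def)

lemma has_sum_norm1: "(k has_sum norm1 k) (supp k)"
  unfolding norm1_def using summable by (subst has_sum_supp_iff) auto

lemma le_norm1: "k j \<le> norm1 k"
proof -
  have "sum k {j} \<le> infsum k UNIV"
    using summable nonneg by (intro finite_sum_le_infsum) auto
  then show ?thesis by (simp add: norm1_def)
qed

lemma norm1_pos: "norm1 k > 0"
proof -
  obtain j where "k j \<noteq> 0" using nontrivial by blast
  then show ?thesis using nonneg[of j] le_norm1[of j] by linarith
qed

lemma summable_log_majorant: "(\<lambda>j. k j * (c + ln (2 + 1 / k j))) summable_on supp k"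
  using summable_on_add[OF summable_on_cmult_left[OF has_sum_imp_summable[OF has_sum_norm1], of c]
      log_summable]
  by (simp add: algebra_simps)

text \<open>The term \<open>ln (1 / k j)\<close> can be negative, namely when \<open>k j > 1\<close>; since \<open>k j\<close> never exceeds the total
  mass, the negative part is bounded by a constant.\<close>

lemma log_mass_summable: "(\<lambda>j. k j * ln (1 / k j)) summable_on supp k"
proof -
  have "norm (k j * ln (1 / k j)) \<le> k j * (ln (1 + norm1 k) + ln (2 + 1 / k j))"
    if "j \<in> supp k" for j
  proof -
    have k: "k j > 0" using supp_pos[OF that] .
    have "1 / k j > 0" using k by simp
    then have "ln (1 / k j) \<le> ln (2 + 1 / k j)" "ln (2 + 1 / k j) \<ge> 0"
      by (intro ln_mono ln_ge_zero; linarith)+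
    moreover have "ln (1 + norm1 k) \<ge> 0" "ln (k j) \<le> ln (1 + norm1 k)"
      using k le_norm1[of j] norm1_pos by auto
    moreover have "ln (1 / k j) = - ln (k j)"
      using k by (simp add: ln_div)
    ultimately have "\<bar>ln (1 / k j)\<bar> \<le> ln (1 + norm1 k) + ln (2 + 1 / k j)"
      by linarith
    then show ?thesis
      using k by (simp add: abs_mult)
  qed
  then have "(\<lambda>j. norm (k j * ln (1 / k j))) summable_on supp k"
    by (rule Infinite_Sum.abs_summable_on_comparison_test'[OF summable_log_majorant])
  then show ?thesis
    by (rule abs_summable_summable)
qed

lemma has_sum_M: "((\<lambda>j. k j * ln (1 / k j)) has_sum M k) (supp k)"
  unfolding M_def by (rule has_sum_infsum[OF log_mass_summable])

text \<open>The upper bound does not depend on \<open>l\<close> in \<open>{0..b}\<close> and is summable over the support, so it serves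
  both for convergence of \<open>\<rho>\<close> and, by the Weierstrass test, for its continuity. It rests on
  \<open>1 + 2 * b / k \<le> (1 + 2 * b) * (2 + 1 / k)\<close>.\<close>

lemma rho_term_bounds:
  assumes "j \<in> supp k" "0 \<le> l" "l \<le> b"
  shows "0 \<le> k j * H'_inv (l / k j)"
    and "k j * H'_inv (l / k j) \<le> k j * (ln (1 + 2 * b) + ln (2 + 1 / k j))"
proof -
  have k: "k j > 0" using supp_pos[OF assms(1)] .
  show "0 \<le> k j * H'_inv (l / k j)"
    using k assms by (simp add: H'_inv_nonneg)
  have "H'_inv (l / k j) \<le> ln (1 + 2 * (l / k j))"
    using k assms by (intro H'_inv_le_ln) simp
  also have "\<dots> \<le> ln ((1 + 2 * b) * (2 + 1 / k j))"
  proof -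
    have "1 + 2 * (l / k j) \<le> 1 + 2 * (b / k j)"
      using k assms by (simp add: divide_right_mono)
    also have "\<dots> \<le> (1 + 2 * b) * (2 + 1 / k j)"
      using k assms by (simp add: algebra_simps)
    finally show ?thesis
      using k assms by (intro ln_mono) (auto intro!: add_pos_nonneg)
  qed
  also have "\<dots> = ln (1 + 2 * b) + ln (2 + 1 / k j)"
    using k assms by (intro ln_mult_pos add_pos_nonneg) auto
  finally show "k j * H'_inv (l / k j) \<le> k j * (ln (1 + 2 * b) + ln (2 + 1 / k j))"
    using k by simp
qed

lemma rho_summable:
  assumes "l \<ge> 0"
  shows "(\<lambda>j. k j * H'_inv (l / k j)) summable_on supp k"
  by (rule summable_on_comparison_test[OF summable_log_majorant[of "ln (1 + 2 * l)"]])
     (use rho_term_bounds[OF _ assms order_refl] in auto)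

lemma rho_eq: "l \<ge> 0 \<Longrightarrow> rho k l = (\<Sum>\<^sub>\<infinity>j\<in>supp k. k j * H'_inv (l / k j))"
  by (cases "l = 0") (simp_all add: rho_def)

lemma has_sum_rho: "l \<ge> 0 \<Longrightarrow> ((\<lambda>j. k j * H'_inv (l / k j)) has_sum rho k l) (supp k)"
  unfolding rho_eq by (rule has_sum_infsum) (rule rho_summable)

lemma rho_0 [simp]: "rho k 0 = 0"
  by (simp add: rho_def)

lemma rho_strict_mono: "strict_mono_on {0..} (rho k)"
proof (rule strict_mono_onI)
  fix l m :: real
  assume lm: "l \<in> {0..}" "m \<in> {0..}" "l < m"
  obtain j0 where j0: "j0 \<in> supp k"
    using nontrivial by (auto simp: supp_def)
  have less: "k j * H'_inv (l / k j) < k j * H'_inv (m / k j)" if "j \<in> supp k" for j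
    using supp_pos[OF that] lm strict_monoD[OF H'_inv_strict_mono, of "l / k j" "m / k j"]
    by (simp add: divide_strict_right_mono)
  show "rho k l < rho k m"
    using lm less j0 by (auto simp: rho_eq intro!: infsum_strict_mono[of _ _ _ j0] rho_summable less_imp_le)
qed

lemma continuous_on_rho: "continuous_on {0..b} (rho k)"
proof -
  have "uniform_limit {0..b} (\<lambda>F l. \<Sum>j\<in>F. k j * H'_inv (l / k j))
      (\<lambda>l. \<Sum>\<^sub>\<infinity>j\<in>supp k. k j * H'_inv (l / k j)) (finite_subsets_at_top (supp k))"
    using rho_term_bounds
    by (intro Weierstrass_m_test_general[OF _ summable_log_majorant[of "ln (1 + 2 * b)"]]) auto
  moreover have "\<forall>\<^sub>F F in finite_subsets_at_top (supp k).
      continuous_on {0..b} (\<lambda>l. \<Sum>j\<in>F. k j * H'_inv (l / k j))"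
  proof (rule eventually_finite_subsets_at_top_weakI, intro continuous_intros)
    fix F j assume "finite F" "F \<subseteq> supp k" "j \<in> F"
    then have "k j \<noteq> 0" by (auto simp: supp_def)
    have "continuous_on UNIV H'_inv"
      using isCont_H'_inv by (simp add: continuous_on_eq_continuous_at)
    then show "continuous_on {0..b} (\<lambda>l. H'_inv (l / k j))"
      by (rule continuous_on_compose2) (use \<open>k j \<noteq> 0\<close> in \<open>auto intro!: continuous_intros\<close>)
  qed
  ultimately have "continuous_on {0..b} (\<lambda>l. \<Sum>\<^sub>\<infinity>j\<in>supp k. k j * H'_inv (l / k j))"
    by (intro uniform_limit_theorem[where F = "finite_subsets_at_top (supp k)"]) auto
  then show ?thesis
    by (rule continuous_on_eq) (simp add: rho_eq)
qed

text \<open>A single term of the series, at an arbitrary point of the support, exceeds any bound once \<open>l\<close> is large.\<close>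

lemma rho_unbounded: "\<exists>l\<ge>0. rho k l \<ge> c"
proof -
  obtain j0 where j0: "j0 \<in> supp k"
    using nontrivial by (auto simp: supp_def)
  define y where "y = max 0 (c / k j0)"
  define l where "l = k j0 * deriv H y"
  have k: "k j0 > 0" using supp_pos[OF j0] .
  have "deriv H y \<ge> deriv H 0"
    unfolding strict_mono_less_eq[OF deriv_H_strict_mono] by (simp add: y_def)
  then have l: "l \<ge> 0"
    using k by (simp add: l_def deriv_H[of 0])
  have "sum (\<lambda>j. k j * H'_inv (l / k j)) {j0} \<le> rho k l"
    unfolding rho_eq[OF l] using rho_term_bounds(1)[OF _ l order_refl] j0
    by (intro finite_sum_le_infsum rho_summable l) auto
  moreover have "k j0 * H'_inv (l / k j0) = k j0 * y"
    using k by (simp add: l_def)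
  moreover have "k j0 * y \<ge> c"
    using k by (simp add: y_def max_def field_simps)
  ultimately show ?thesis
    using l by auto
qed

lemma rho_bij: "bij_betw (rho k) {0..} {0..}"
  unfolding bij_betw_def
proof
  show "inj_on (rho k) {0..}"
    using rho_strict_mono by (rule strict_mono_on_imp_inj_on)
  show "rho k ` {0..} = {0..}"
  proof (intro equalityI subsetI)
    fix a assume "a \<in> rho k ` {0..}"
    then show "a \<in> {0..}"
      using rho_term_bounds(1) by (auto simp: rho_eq intro!: infsum_nonneg)
  next
    fix a :: real assume a: "a \<in> {0..}"
    obtain b where "b \<ge> 0" "rho k b \<ge> a"
      using rho_unbounded by blast
    then have "\<exists>l\<ge>0. l \<le> b \<and> rho k l = a"
      using a by (intro IVT' continuous_on_rho) auto
    then show "a \<in> rho k ` {0..}" by auto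
  qed
qed

lemma rho_rho_inv: "a \<ge> 0 \<Longrightarrow> rho k (rho_inv k a) = a"
  unfolding rho_inv_def using rho_bij by (simp add: f_the_inv_into_f_bij_betw)

lemma rho_inv_rho: "l \<ge> 0 \<Longrightarrow> rho_inv k (rho k l) = l"
  unfolding rho_inv_def using rho_bij by (simp add: bij_betw_def the_inv_into_f_f)

lemma rho_inv_nonneg:
  assumes "a \<ge> 0"
  shows "rho_inv k a \<ge> 0"
proof -
  have "a \<in> rho k ` {0..}"
    using assms bij_betw_imp_surj_on[OF rho_bij] by simp
  then show ?thesis
    by (auto simp: rho_inv_rho)
qed

lemma rho_inv_0 [simp]: "rho_inv k 0 = 0"
  using rho_inv_rho[of 0] by simp

lemma rho_inv_strict_mono: "strict_mono_on {0..} (rho_inv k)"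
proof (rule strict_mono_onI)
  fix a b :: real
  assume ab: "a \<in> {0..}" "b \<in> {0..}" "a < b"
  show "rho_inv k a < rho_inv k b"
  proof (rule ccontr)
    assume "\<not> rho_inv k a < rho_inv k b"
    then have "rho k (rho_inv k b) \<le> rho k (rho_inv k a)"
      using strict_mono_on_leD[OF rho_strict_mono, of "rho_inv k b" "rho_inv k a"] ab rho_inv_nonneg
      by auto
    then show False
      using ab by (simp add: rho_rho_inv)
  qed
qed

lemma continuous_on_rho_inv: "continuous_on {0..} (rho_inv k)"
proof (rule continuous_on_atLeast)
  fix b :: real
  show "continuous_on {0..b} (rho_inv k)"
  proof (cases "b \<ge> 0")
    case True
    have "continuous_on (rho k ` {0..rho_inv k b}) (rho_inv k)"
      by (rule continuous_on_inv[OF continuous_on_rho]) (auto simp: rho_inv_rho)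
    moreover have "{0..b} \<subseteq> rho k ` {0..rho_inv k b}"
    proof
      fix a assume a: "a \<in> {0..b}"
      then have "rho_inv k a \<le> rho_inv k b"
        using strict_mono_on_leD[OF rho_inv_strict_mono, of a b] by auto
      then show "a \<in> rho k ` {0..rho_inv k b}"
        using a rho_inv_nonneg by (intro image_eqI[of _ _ "rho_inv k a"]) (auto simp: rho_rho_inv)
    qed
    ultimately show ?thesis
      by (rule continuous_on_subset)
  qed auto
qed

lemma filterlim_rho_inv: "filterlim (rho_inv k) at_top at_top"
  unfolding filterlim_at_top
proof
  fix Z :: real
  define l where "l = max 0 Z"
  show "\<forall>\<^sub>F a in at_top. Z \<le> rho_inv k a"
    using eventually_ge_at_top[of "rho k l"]
  proof eventually_elim
    case (elim a)
    have "rho k l \<ge> 0"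
      using bij_betw_imp_surj_on[OF rho_bij] by (auto simp: l_def)
    then have "rho_inv k (rho k l) \<le> rho_inv k a"
      using elim by (intro strict_mono_on_leD[OF rho_inv_strict_mono]) auto
    then show ?case
      by (simp add: rho_inv_rho l_def)
  qed
qed

section \<open>The constrained minimum of the energy\<close>

text \<open>By the Lagrange condition \<open>(k j)\<^sup>2 * H' (y j) = \<lambda> * k j\<close>, these are the values \<open>y j\<close> that
  minimize \<open>\<Sum>j. (k j)\<^sup>2 * H (y j)\<close> subject to \<open>\<Sum>j. k j * y j = a\<close>. Summing the solution
  \<open>y j = (H')\<^sup>-\<^sup>1 (\<lambda> / k j)\<close> against \<open>k\<close> shows that the multiplier is \<open>\<lambda> = \<rho>\<^sup>-\<^sup>1 a\<close>.\<close>

definition optimal_increment :: "real \<Rightarrow> int \<Rightarrow> real" where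
  "optimal_increment a j = H'_inv (rho_inv k a / k j)"

definition min_energy :: "real \<Rightarrow> real" where
  "min_energy a = (\<Sum>\<^sub>\<infinity>j\<in>supp k. (k j)\<^sup>2 * H (optimal_increment a j))"

lemma has_sum_optimal_increment:
  "a \<ge> 0 \<Longrightarrow> ((\<lambda>j. k j * optimal_increment a j) has_sum a) (supp k)"
  unfolding optimal_increment_def using has_sum_rho[OF rho_inv_nonneg, of a]
  by (simp only: rho_rho_inv)

lemma min_energy_summable:
  assumes "a \<ge> 0"
  shows "(\<lambda>j. (k j)\<^sup>2 * H (optimal_increment a j)) summable_on supp k"
proof (rule summable_on_comparison_test)
  show "(\<lambda>j. k j * rho_inv k a) summable_on supp k"
    using has_sum_norm1 has_sum_imp_summable by (intro summable_on_cmult_left) blast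
next
  fix j assume "j \<in> supp k"
  then have k: "k j > 0" by (rule supp_pos)
  then have "H (optimal_increment a j) \<le> rho_inv k a / k j"
    using H_le_deriv_H[of "optimal_increment a j"] rho_inv_nonneg[OF assms]
    by (simp add: optimal_increment_def H'_inv_nonneg)
  then have "(k j)\<^sup>2 * H (optimal_increment a j) \<le> (k j)\<^sup>2 * (rho_inv k a / k j)"
    by (rule mult_left_mono) simp
  then show "(k j)\<^sup>2 * H (optimal_increment a j) \<le> k j * rho_inv k a"
    using k by (simp add: power2_eq_square)
qed (simp add: H_nonneg)

text \<open>Summing the tangent inequality of \<open>H\<close> at the optimal values: because \<open>H'\<close> equals \<open>\<lambda> / k j\<close>
  there, the linear terms add up to the multiplier times the change of the constraint. For \<open>b = a\<close>
  this is optimality; for general \<open>b\<close> it says that \<open>\<rho>\<^sup>-\<^sup>1 a\<close> is a subgradient of the minimal energy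
  at \<open>a\<close>.\<close>

lemma min_energy_le:
  assumes a: "a \<ge> 0"
    and s: "((\<lambda>j. k j * s j) has_sum b) (supp k)"
    and summable: "(\<lambda>j. (k j)\<^sup>2 * H (s j)) summable_on supp k"
  shows "min_energy a + rho_inv k a * (b - a) \<le> (\<Sum>\<^sub>\<infinity>j\<in>supp k. (k j)\<^sup>2 * H (s j))"
proof (rule has_sum_mono)
  show "((\<lambda>j. (k j)\<^sup>2 * H (optimal_increment a j)
            + rho_inv k a * (k j * s j - k j * optimal_increment a j))
          has_sum (min_energy a + rho_inv k a * (b - a))) (supp k)"
    unfolding min_energy_def using min_energy_summable[OF a] has_sum_optimal_increment[OF a] s
    by (intro has_sum_add has_sum_cmult_right has_sum_diff has_sum_infsum)
  show "((\<lambda>j. (k j)\<^sup>2 * H (s j)) has_sum (\<Sum>\<^sub>\<infinity>j\<in>supp k. (k j)\<^sup>2 * H (s j))) (supp k)"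
    using summable by (rule has_sum_infsum)
next
  fix j assume "j \<in> supp k"
  then have k: "k j > 0" by (rule supp_pos)
  define y where "y = optimal_increment a j"
  have "H y + rho_inv k a / k j * (s j - y) \<le> H (s j)"
    using H_above_tangent[of y "s j"] by (simp add: y_def optimal_increment_def)
  then have "(k j)\<^sup>2 * (H y + rho_inv k a / k j * (s j - y)) \<le> (k j)\<^sup>2 * H (s j)"
    by (rule mult_left_mono) simp
  then show "(k j)\<^sup>2 * H y + rho_inv k a * (k j * s j - k j * y) \<le> (k j)\<^sup>2 * H (s j)"
    using k by (simp add: power2_eq_square distrib_left) (simp add: algebra_simps)
qed

lemma min_energy_subgradient:
  assumes "a \<in> {0..}" "b \<in> {0..}"
  shows "min_energy a + rho_inv k a * (b - a) \<le> min_energy b"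
  using assms unfolding min_energy_def[of b]
  by (intro min_energy_le has_sum_optimal_increment min_energy_summable) simp_all

text \<open>The subgradient \<open>\<rho>\<^sup>-\<^sup>1\<close> is continuous, hence it is the derivative of the minimal energy, and the
  fundamental theorem of calculus identifies the latter with the integral \<open>G\<close>.\<close>

lemma G_eq_min_energy:
  assumes "a \<ge> 0"
  shows "G k a = min_energy a"
proof -
  have "(min_energy has_vector_derivative rho_inv k x) (at x within {0..a})" if "x \<in> {0..a}" for x
    using has_real_derivative_subgradient[OF min_energy_subgradient continuous_on_rho_inv, of x] that
    by (auto simp: has_real_derivative_iff_has_vector_derivative[symmetric] intro: DERIV_subset)
  then have "(rho_inv k has_integral (min_energy a - min_energy 0)) {0..a}"
    using assms by (intro fundamental_theorem_of_calculus)
  moreover have "min_energy 0 = 0"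
    by (simp add: min_energy_def optimal_increment_def H_eq)
  ultimately show ?thesis
    unfolding G_def by (simp add: integral_unique)
qed

lemma G_subgradient:
  "x \<in> {0..} \<Longrightarrow> y \<in> {0..} \<Longrightarrow> G k x + rho_inv k x * (y - x) \<le> G k y"
  using min_energy_subgradient by (simp add: G_eq_min_energy)

lemma G_has_derivative:
  "x \<in> {0..} \<Longrightarrow> (G k has_real_derivative rho_inv k x) (at x within {0..})"
  using G_subgradient continuous_on_rho_inv by (rule has_real_derivative_subgradient)

lemma continuous_on_G: "continuous_on {0..} (G k)"
  by (rule DERIV_continuous_on) (rule G_has_derivative)

lemma G_strictly_convex: "strictly_convex_on {0..} (G k)"
  by (rule strictly_convex_on_subgradient[OF _ G_subgradient rho_inv_strict_mono]) simp_all

lemma G_0 [simp]: "G k 0 = 0"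
  by (simp add: G_def)

lemma G_nonneg: "a \<ge> 0 \<Longrightarrow> G k a \<ge> 0"
  by (simp add: G_eq_min_energy min_energy_def infsum_nonneg H_nonneg)

section \<open>The curvature-dimension inequality\<close>

text \<open>The symmetrized increments of \<open>u\<close> are admissible for the minimization problem with constraint
  value \<open>- L u\<close>, so their energy is at least \<open>G (- L u)\<close>.\<close>

lemma satisfies_CD: "satisfies_CD_Upsilon_0 k (G k)"
  unfolding satisfies_CD_Upsilon_0_def
proof (intro allI impI)
  fix u :: "int \<Rightarrow> real" and x
  assume u: "bounded (range u)"
  define s where "s j = - (increment u x j + increment u x (- j)) / 2" for j
  note ge = Psi2_Upsilon_ge[OF u, of x, folded s_def]
  have s: "((\<lambda>j. k j * s j) has_sum (- L k u x)) (supp k)"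
    using symmetrized_increment[OF u, of x] by (subst has_sum_supp_iff) (simp_all add: s_def)
  have energy: "((\<lambda>j. (k j)\<^sup>2 * H (s j)) has_sum (\<Sum>\<^sub>\<infinity>j. (k j)\<^sup>2 * H (s j))) (supp k)"
    using ge(1) by (subst has_sum_supp_iff) auto
  show "(if - L k u x \<ge> 0 then G k (- L k u x) else 0) \<le> Psi2_Upsilon k u x"
  proof (cases "- L k u x \<ge> 0")
    case True
    have "G k (- L k u x) \<le> (\<Sum>\<^sub>\<infinity>j. (k j)\<^sup>2 * H (s j))"
      using min_energy_le[OF True s has_sum_imp_summable[OF energy]] energy
      by (simp add: G_eq_min_energy[OF True] infsumI)
    then show ?thesis
      using True ge(2) by simp
  next
    case False
    have "0 \<le> (\<Sum>\<^sub>\<infinity>j. (k j)\<^sup>2 * H (s j))"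
      by (intro infsum_nonneg) (simp add: H_nonneg)
    then show ?thesis
      using False ge(2) by simp
  qed
qed

section \<open>Asymptotics\<close>

text \<open>Replacing \<open>(H')\<^sup>-\<^sup>1 s\<close> by \<open>ln (2 * s)\<close> in each term gives the stated main part exactly. The error is
  uniform in \<open>j\<close> because \<open>k j \<le> |k|\<^sub>1\<close> forces \<open>l / k j \<ge> l / |k|\<^sub>1\<close>.\<close>

lemma rho_asymp: "((\<lambda>l. rho k l - (norm1 k * ln (2 * l) + M k)) \<longlongrightarrow> 0) at_top"
proof (rule tendstoI)
  fix e :: real
  assume e: "e > 0"
  define e' where "e' = e / (2 * norm1 k)"
  have e': "e' > 0" "norm1 k * e' < e"
    using e norm1_pos by (simp_all add: e'_def)
  have "\<forall>\<^sub>F s in at_top. \<bar>H'_inv s - ln (2 * s)\<bar> < e'"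
    using tendstoD[OF H'_inv_asymp e'(1)] by (simp add: dist_real_def)
  then obtain S where S: "\<And>s. s \<ge> S \<Longrightarrow> \<bar>H'_inv s - ln (2 * s)\<bar> < e'"
    by (auto simp: eventually_at_top_linorder)
  have "dist (rho k l - (norm1 k * ln (2 * l) + M k)) 0 < e"
    if l: "l \<ge> max 1 (\<bar>S\<bar> * norm1 k)" for l
  proof -
    have l0: "l > 0" using l by linarith
    have 1: "((\<lambda>j. k j * H'_inv (l / k j) - (k j * ln (2 * l) + k j * ln (1 / k j)))
        has_sum (rho k l - (norm1 k * ln (2 * l) + M k))) (supp k)"
      using l0 by (intro has_sum_diff has_sum_add has_sum_cmult_left has_sum_rho has_sum_norm1 has_sum_M) auto
    have 2: "((\<lambda>j. k j * e') has_sum (norm1 k * e')) (supp k)"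
      by (intro has_sum_cmult_left has_sum_norm1)
    have "norm (rho k l - (norm1 k * ln (2 * l) + M k)) \<le> norm1 k * e'"
    proof (rule norm_infsum_le[OF 1 2])
      fix j assume "j \<in> supp k"
      then have k: "k j > 0" by (rule supp_pos)
      have "S \<le> l / k j"
      proof -
        have "S * k j \<le> \<bar>S\<bar> * norm1 k"
          using le_norm1[of j] k by (intro mult_mono) auto
        then show ?thesis
          using k l by (simp add: le_divide_eq)
      qed
      from S[OF this] have "\<bar>H'_inv (l / k j) - ln (2 * (l / k j))\<bar> \<le> e'"
        by simp
      moreover have "ln (2 * (l / k j)) = ln (2 * l) + ln (1 / k j)"
        using l0 k by (subst ln_mult_pos[symmetric]) auto
      ultimately have "k j * \<bar>H'_inv (l / k j) - (ln (2 * l) + ln (1 / k j))\<bar> \<le> k j * e'"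
        using k by simp
      moreover have "k j * H'_inv (l / k j) - (k j * ln (2 * l) + k j * ln (1 / k j))
          = k j * (H'_inv (l / k j) - (ln (2 * l) + ln (1 / k j)))"
        by (simp add: algebra_simps)
      ultimately show "norm (k j * H'_inv (l / k j) - (k j * ln (2 * l) + k j * ln (1 / k j))) \<le> k j * e'"
        using k by (simp add: abs_mult)
    qed
    then show ?thesis
      using e' by simp
  qed
  then show "\<forall>\<^sub>F l in at_top. dist (rho k l - (norm1 k * ln (2 * l) + M k)) 0 < e"
    unfolding eventually_at_top_linorder by blast
qed

lemma rho_inv_asymp:
  "((\<lambda>a. rho_inv k a / (exp ((a - M k) / norm1 k) / 2)) \<longlongrightarrow> 1) at_top"
proof -
  have "((\<lambda>a. rho k (rho_inv k a) - (norm1 k * ln (2 * rho_inv k a) + M k)) \<longlongrightarrow> 0) at_top"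
    using filterlim_compose[OF rho_asymp filterlim_rho_inv] .
  then have "((\<lambda>a. exp (- ((rho k (rho_inv k a) - (norm1 k * ln (2 * rho_inv k a) + M k)) / norm1 k)))
      \<longlongrightarrow> exp (- (0 / norm1 k))) at_top"
    using norm1_pos by (intro tendsto_intros) auto
  moreover have "\<forall>\<^sub>F a in at_top.
      exp (- ((rho k (rho_inv k a) - (norm1 k * ln (2 * rho_inv k a) + M k)) / norm1 k))
        = rho_inv k a / (exp ((a - M k) / norm1 k) / 2)"
    using eventually_gt_at_top[of 0]
  proof eventually_elim
    case (elim a)
    then have pos: "rho_inv k a > 0"
      using strict_mono_onD[OF rho_inv_strict_mono, of 0 a] by simp
    have "- ((a - (norm1 k * ln (2 * rho_inv k a) + M k)) / norm1 k)
        = ln (2 * rho_inv k a) - (a - M k) / norm1 k"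
      using norm1_pos by (simp add: field_simps)
    then show ?case
      using elim pos by (simp add: rho_rho_inv exp_diff)
  qed
  ultimately show ?thesis
    by (simp add: filterlim_cong)
qed

text \<open>The exponential on the right has derivative \<open>exp ((a - M k) / norm1 k) / 2\<close>, which is asymptotic to
  \<open>\<rho>\<^sup>-\<^sup>1 = G'\<close>; the rule of l'Hospital transfers the equivalence to the primitives.\<close>

lemma G_asymp: "G k \<sim>[at_top] (\<lambda>a. norm1 k / 2 * exp ((a - M k) / norm1 k))"
proof (rule asymp_equivI', rule lhospital_at_top_at_top)
  show "filterlim (\<lambda>a. norm1 k / 2 * exp ((a - M k) / norm1 k)) at_top at_top"
  proof -
    have "filterlim (\<lambda>a::real. N / 2 * exp ((a - m) / N)) at_top at_top" if "N > 0" for N m :: real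
      using that by real_asymp
    from this[OF norm1_pos] show ?thesis .
  qed
  show "\<forall>\<^sub>F a in at_top. exp ((a - M k) / norm1 k) / 2 \<noteq> 0"
    by simp
  show "\<forall>\<^sub>F a in at_top. (G k has_real_derivative rho_inv k a) (at a)"
    using eventually_gt_at_top[of 0]
  proof eventually_elim
    case (elim a)
    then have "at a within {0..} = at a"
      by (intro at_within_interior) auto
    then show ?case
      using G_has_derivative[of a] elim by simp
  qed
  show "\<forall>\<^sub>F a in at_top. ((\<lambda>a. norm1 k / 2 * exp ((a - M k) / norm1 k))
      has_real_derivative exp ((a - M k) / norm1 k) / 2) (at a)"
    using norm1_pos by (intro always_eventually allI) (auto intro!: derivative_eq_intros)
  show "((\<lambda>a. rho_inv k a / (exp ((a - M k) / norm1 k) / 2)) \<longlongrightarrow> 1) at_top"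
    by (rule rho_inv_asymp)
qed

lemma inverse_G_integrable: "\<exists>R>0. set_integrable lborel {R..} (\<lambda>r. 1 / G k r)"
proof -
  define E where "E a = norm1 k / 2 * exp ((a - M k) / norm1 k)" for a
  have E_pos: "E a > 0" for a
    using norm1_pos by (simp add: E_def)
  have "((\<lambda>a. G k a / E a) \<longlongrightarrow> 1) at_top"
    using asymp_equivD_strong[OF G_asymp] E_pos unfolding E_def[symmetric]
    by (simp add: less_imp_neq[symmetric])
  then have "\<forall>\<^sub>F a in at_top. G k a / E a > 1 / 2"
    by (rule order_tendstoD) simp
  then obtain R0 where R0: "\<And>a. a \<ge> R0 \<Longrightarrow> G k a / E a > 1 / 2"
    by (auto simp: eventually_at_top_linorder)
  define R where "R = max 1 R0"
  (* The lower bound E a / 2 for G a becomes 2 / E a = C * exp (- a / norm1 k) for 1 / G a. *)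
  define C where "C = 4 / norm1 k * exp (M k / norm1 k)"
  have G_ge: "G k a > E a / 2" if "a \<ge> R" for a
    using R0[of a] that E_pos[of a] by (simp add: R_def field_simps)
  have "set_integrable lborel {R..} (\<lambda>r. 1 / G k r)"
  proof (rule set_integrable_bound)
    show "set_integrable lborel {R..} (\<lambda>r. C * exp (- (1 / norm1 k) * r))"
      using norm1_pos by (intro set_integrable_mult_right set_integrable_exp_decay) simp
    have "G k a \<noteq> 0" if "a \<ge> R" for a
      using G_ge[OF that] E_pos[of a] by simp
    moreover have "continuous_on {R..} (G k)"
      by (rule continuous_on_subset[OF continuous_on_G]) (auto simp: R_def)
    ultimately have "continuous_on {R..} (\<lambda>r. 1 / G k r)"
      by (intro continuous_intros) auto
    then have "(\<lambda>r. indicator {R..} r *\<^sub>R (1 / G k r)) \<in> borel_measurable borel"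
      by (intro borel_measurable_continuous_on_indicator) auto
    then show "set_borel_measurable lborel {R..} (\<lambda>r. 1 / G k r)"
      unfolding set_borel_measurable_def by simp
    show "AE r in lborel. r \<in> {R..} \<longrightarrow> norm (1 / G k r) \<le> norm (C * exp (- (1 / norm1 k) * r))"
    proof (intro AE_I2 impI)
      fix r assume "r \<in> {R..}"
      then have r: "G k r > E r / 2" using G_ge[of r] by simp
      have "1 / G k r \<le> 1 / (E r / 2)"
        using r E_pos[of r] by (intro divide_left_mono) auto
      also have "\<dots> = C * exp (- (1 / norm1 k) * r)"
      proof -
        define t where "t = (r - M k) / norm1 k"
        have "- t = M k / norm1 k + - (1 / norm1 k) * r"
          by (simp add: t_def diff_divide_distrib)
        then have "C * exp (- (1 / norm1 k) * r) = 4 / norm1 k * exp (- t)"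
          by (simp only: C_def exp_add mult.assoc)
        moreover have "1 / (E r / 2) = 4 / norm1 k * exp (- t)"
          unfolding E_def t_def[symmetric] exp_minus inverse_eq_divide by simp
        ultimately show ?thesis
          by (simp only:)
      qed
      finally show "norm (1 / G k r) \<le> norm (C * exp (- (1 / norm1 k) * r))"
        using r E_pos[of r] by simp
    qed
  qed
  then show ?thesis
    by (intro exI[of _ R]) (simp add: R_def)
qed

lemma G_CD_function: "CD_function (G k)"
  unfolding CD_function_def
  using continuous_on_G G_nonneg strictly_convex_on_quotient_strict_mono[OF G_strictly_convex]
    inverse_G_integrable by simp

end

theorem theorem3p4:
  fixes k :: "int \<Rightarrow> real"
  assumes k_nonneg: "\<And>j. k j \<ge> 0"
    and k_nontrivial: "\<exists>j. k j \<noteq> 0"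
    and k_zero: "k 0 = 0"
    and k_symmetric: "\<And>j. k j = k (- j)"
    and k_summable: "k summable_on UNIV"
    and k_log: "(\<lambda>j. k j * ln (2 + 1 / k j)) summable_on supp k"
  shows
    \<comment> \<open>well-definedness of \<open>\<rho>\<close>, \<open>\<rho>\<^sup>-\<^sup>1\<close> and \<open>M(k)\<close>\<close>
    "(\<forall>l>0. (\<lambda>j. k j * inv (deriv H) (l / k j)) summable_on supp k) \<and>
     strict_mono_on {0..} (rho k) \<and> bij_betw (rho k) {0..} {0..} \<and>
     (\<lambda>j. k j * ln (1 / k j)) summable_on supp k \<and>
     strictly_convex_on {0..} (G k) \<and> CD_function (G k) \<and>
     satisfies_CD_Upsilon_0 k (G k) \<and>
     G k \<sim>[at_top] (\<lambda>a. norm1 k / 2 * exp ((a - M k) / norm1 k))"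
proof -
  interpret log_kernel k
    using assms by unfold_locales auto
  show ?thesis
    using rho_summable rho_strict_mono rho_bij log_mass_summable G_strictly_convex G_CD_function
      satisfies_CD G_asymp by simp
qed

end
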